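(* Let $X$ be a sequentially Hausdorff Fréchet topological space, let $Y$ be a Hausdorff topological space, and let $f:X\to Y$ be a compact-preserving function. Then: (1) the set $SI_f$ is closed in $X$; (2) $LI'_f\subset SI_f\subset LI_f$; (3) $SI_f=LI_f$ provided that $X$ is strong Fréchet.
   Context: A function $f:X\to Y$ between topological spaces (not assumed continuous) is compact-preserving if the image $f(K)$ of each compact subset $K\subset X$ is compact. Compact means that every open cover has a finite subcover (no separation axiom included). A topological space $X$ is sequentially Hausdorff if each convergent sequence in $X$ has a unique limit. It is Fréchet if for each subset $A\subset X$ and each point $a\in\bar A$ there is a sequence of points of $A$ that converges to $a$. It is strong Fréchet if for any decreasing sequence $(A_n)_{n\in\omega}$ of subsets of $X$ and any point $a\in\bigcap_{n\in\omega}\bar A_n$ there is a sequence of points $a_n\in A_n$, $n\in\omega$, that converges to $a$. A function $f:X\to Y$ is locally finite at $x\in X$ if for some neighborhood $O_x\subset X$ of $x$ the image $f(O_x)$ is finite; it is locally infinite at $x$ if it is not locally finite at $x$; it is sequentially infinite at $x$ if there is a sequence $(x_n)_{n\in\omega}$ in $X$ that converges to $x$ and has infinite image $\{f(x_n)\}_{n\in\omega}$. $LI_f$ and $SI_f$ denote the sets of points $x\in X$ at which $f$ is locally infinite and sequentially infinite, respectively. $LI'_f$ denotes the set of non-isolated points of the subspace $LI_f$. *)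

theory Defs
  imports "HOL-Analysis.Analysis"
begin

text \<open>
  Spaces are values of type \<open>'a topology\<close>, so points are restricted to the carrier
  \<open>topspace X\<close>. As \<open>limitin\<close> lets a sequence leave the carrier
  finitely often, the range of every sequence is required explicitly to lie in the carrier.
\<close>

definition sequentially_Hausdorff_space :: "'a topology \<Rightarrow> bool" where
  "sequentially_Hausdorff_space X \<longleftrightarrow>
     (\<forall>s a b. range s \<subseteq> topspace X \<and> limitin X s a sequentially \<and> limitin X s b sequentially
        \<longrightarrow> a = b)"

definition Frechet_space :: "'a topology \<Rightarrow> bool" where
  "Frechet_space X \<longleftrightarrow>
     (\<forall>A a. A \<subseteq> topspace X \<and> a \<in> X closure_of A
        \<longrightarrow> (\<exists>s :: nat \<Rightarrow> 'a. range s \<subseteq> A \<and> limitin X s a sequentially))"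

definition strong_Frechet_space :: "'a topology \<Rightarrow> bool" where
  "strong_Frechet_space X \<longleftrightarrow>
     (\<forall>(A :: nat \<Rightarrow> 'a set) a.
        decseq A \<and> (\<forall>n. A n \<subseteq> topspace X) \<and> a \<in> (\<Inter>n. X closure_of A n)
        \<longrightarrow> (\<exists>s. (\<forall>n. s n \<in> A n) \<and> limitin X s a sequentially))"

definition compact_preserving :: "'a topology \<Rightarrow> 'b topology \<Rightarrow> ('a \<Rightarrow> 'b) \<Rightarrow> bool" where
  "compact_preserving X Y f \<longleftrightarrow> (\<forall>K. compactin X K \<longrightarrow> compactin Y (f ` K))"

definition locally_finite_at :: "'a topology \<Rightarrow> ('a \<Rightarrow> 'b) \<Rightarrow> 'a \<Rightarrow> bool" where
  "locally_finite_at X f x \<longleftrightarrow> (\<exists>U. openin X U \<and> x \<in> U \<and> finite (f ` U))"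

definition locally_infinite_at :: "'a topology \<Rightarrow> ('a \<Rightarrow> 'b) \<Rightarrow> 'a \<Rightarrow> bool" where
  "locally_infinite_at X f x \<longleftrightarrow> \<not> locally_finite_at X f x"

definition sequentially_infinite_at :: "'a topology \<Rightarrow> ('a \<Rightarrow> 'b) \<Rightarrow> 'a \<Rightarrow> bool" where
  "sequentially_infinite_at X f x \<longleftrightarrow>
     (\<exists>s. range s \<subseteq> topspace X \<and> limitin X s x sequentially \<and> infinite (range (\<lambda>n. f (s n))))"

definition LI :: "'a topology \<Rightarrow> ('a \<Rightarrow> 'b) \<Rightarrow> 'a set" where
  "LI X f = {x \<in> topspace X. locally_infinite_at X f x}"

definition SI :: "'a topology \<Rightarrow> ('a \<Rightarrow> 'b) \<Rightarrow> 'a set" where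
  "SI X f = {x \<in> topspace X. sequentially_infinite_at X f x}"

definition nonisolated_points :: "'a topology \<Rightarrow> 'a set" where
  "nonisolated_points X = {x \<in> topspace X. \<not> openin X {x}}"

definition LI' :: "'a topology \<Rightarrow> ('a \<Rightarrow> 'b) \<Rightarrow> 'a set" where
  "LI' X f = nonisolated_points (subtopology X (LI X f))"

end

theory Submission
  imports Defs
begin

text \<open>
  If \<open>x\<close> is the limit of points \<open>xs n \<noteq> x\<close>, each in the closure of a set \<open>A n\<close>, and every value
  of \<open>f\<close> is taken on only finitely many of the \<open>A n\<close>, then thinning the \<open>A n\<close> to sequences
  converging to \<open>xs n\<close> and extracting from their union a sequence converging to \<open>x\<close> shows that
  \<open>f\<close> is sequentially infinite at \<open>x\<close>: a sequence with finite image would stay in finitely many of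
  the thinned sets, whose closures miss \<open>x\<close>. For \<open>xs n\<close> in \<open>SI\<close> such \<open>A n\<close> are found by discarding
  finitely many values from a sequence witnessing \<open>xs n \<in> SI\<close>. At a point of \<open>LI - SI\<close> infinitely
  many fibres of \<open>f\<close> accumulate, so for \<open>xs n\<close> in \<open>LI - SI\<close> one takes \<open>A n\<close> to be pairwise
  different fibres. In a strong Frechet space the tails of the union of such fibres at a single
  point already yield a sequence with infinite image.
\<close>

section \<open>Convergent sequences and closures\<close>

lemma limitin_sequentially_in_closure_of:
  assumes "limitin X s a sequentially" and "range s \<subseteq> A"
  shows "a \<in> X closure_of A"
  using assms unfolding limitin_sequentially in_closure_of by (meson order_refl range_subsetD)

text \<open>Neither monotonicity nor injectivity of \<open>j\<close> matters:
  \<open>i \<le> j i\<close> alone sends the indices to infinity.\<close>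

lemma limitin_sequentially_reindex:
  fixes j :: "nat \<Rightarrow> nat"
  assumes "limitin X s a sequentially" and "\<And>i. i \<le> j i"
  shows "limitin X (\<lambda>i. s (j i)) a sequentially"
  using assms unfolding limitin_sequentially by (meson order_trans)

text \<open>A point \<open>w\<close> of the closure is the limit of some \<open>z (k j)\<close>. If
  \<open>k\<close> takes arbitrarily large values at arbitrarily large \<open>j\<close>, one
  reindexing converges both to \<open>w\<close> and to \<open>a\<close>. Otherwise the sequence
  eventually stays among finitely many \<open>z m\<close>; then \<open>w\<close> lies in the closure
  of one of them and equals it, since a constant sequence has only one limit.\<close>

lemma closure_of_convergent_sequence:
  fixes z :: "nat \<Rightarrow> 'a"
  assumes H: "sequentially_Hausdorff_space X" and F: "Frechet_space X"
    and z: "range z \<subseteq> topspace X" "limitin X z a sequentially"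
  shows "X closure_of (range z) \<subseteq> insert a (range z)"
proof
  fix w assume "w \<in> X closure_of (range z)"
  then obtain t where t: "range t \<subseteq> range z" "limitin X t w sequentially"
    using F z(1) unfolding Frechet_space_def by blast
  then have "\<forall>j. \<exists>k. t j = z k" by blast
  then obtain k where k: "\<And>j. t j = z (k j)" by metis
  have w: "w \<in> topspace X" using t(2) by (simp add: limitin_def)
  show "w \<in> insert a (range z)"
  proof (cases "\<forall>i. \<exists>j\<ge>i. i \<le> k j")
    case True
    then obtain j where j: "\<And>i. i \<le> j i" "\<And>i. i \<le> k (j i)" by metis
    have "limitin X (\<lambda>i. t (j i)) w sequentially"
      by (rule limitin_sequentially_reindex[OF t(2) j(1)])
    moreover have "limitin X (\<lambda>i. t (j i)) a sequentially"
      unfolding k by (rule limitin_sequentially_reindex[OF z(2) j(2)])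
    moreover have "range (\<lambda>i. t (j i)) \<subseteq> topspace X" using t(1) z(1) by blast
    ultimately have "w = a" using H unfolding sequentially_Hausdorff_space_def by blast
    then show ?thesis by simp
  next
    case False
    then obtain i where i: "\<And>j. i \<le> j \<Longrightarrow> k j < i" by (meson not_le)
    have "limitin X (\<lambda>j. t (j + i)) w sequentially"
      by (rule limitin_sequentially_reindex[OF t(2)]) simp
    moreover have "range (\<lambda>j. t (j + i)) \<subseteq> z ` {..<i}" using i k by auto
    ultimately have "w \<in> X closure_of (z ` {..<i})"
      by (rule limitin_sequentially_in_closure_of)
    moreover have "X closure_of (z ` {..<i}) = (\<Union>m\<in>{..<i}. X closure_of {z m})"
      using closure_of_Union[of "(\<lambda>m. {z m}) ` {..<i}" X] by (simp add: UNION_singleton_eq_range)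
    ultimately obtain m where m: "w \<in> X closure_of {z m}" by auto
    then obtain u where u: "range u \<subseteq> {z m}" "limitin X u w sequentially"
      using F z(1) unfolding Frechet_space_def by (metis empty_subsetI insert_subset range_subsetD)
    then have "limitin X u (z m) sequentially" 
      using z(1) by (auto simp: limitin_sequentially image_subset_iff)
    moreover have "range u \<subseteq> topspace X" using u(1) z(1) by blast
    ultimately have "w = z m" using H u(2) unfolding sequentially_Hausdorff_space_def by blast
    then show ?thesis by simp
  qed
qed

text \<open>Singletons are closed: apply the previous lemma to a constant sequence.\<close>

lemma in_closure_of_Diff_singleton:
  assumes H: "sequentially_Hausdorff_space X" and F: "Frechet_space X"
    and x: "x \<in> topspace X" and a: "a \<in> X closure_of A" "a \<noteq> x"
  shows "a \<in> X closure_of (A - {x})"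
proof -
  have "limitin X (\<lambda>n. x) x sequentially" using x by (simp add: limitin_sequentially)
  then have "X closure_of {x} \<subseteq> {x}"
    using closure_of_convergent_sequence[OF H F, of "\<lambda>n. x" x] x by simp
  moreover have "a \<in> X closure_of (A - {x}) \<union> X closure_of {x}"
    using a(1) closure_of_mono[of A "(A - {x}) \<union> {x}" X] by (auto simp flip: closure_of_Un)
  ultimately show ?thesis using a(2) by blast
qed

section \<open>Sequential infinity at a limit of points\<close>

lemma sequentially_infinite_at_limit:
  fixes A :: "nat \<Rightarrow> 'a set"
  assumes H: "sequentially_Hausdorff_space X" and F: "Frechet_space X"
    and lim: "limitin X xs x sequentially" and ne: "\<And>n. xs n \<noteq> x"
    and A: "\<And>n. A n \<subseteq> topspace X" "\<And>n. xs n \<in> X closure_of (A n)"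
    and fin: "\<And>v. finite {n. v \<in> f ` A n}"
  shows "sequentially_infinite_at X f x"
proof -
  have x: "x \<in> topspace X" using lim by (simp add: limitin_def)
  have "\<exists>z. range z \<subseteq> A n - {x} \<and> limitin X z (xs n) sequentially" for n
  proof -
    have "xs n \<in> X closure_of (A n - {x})"
      by (rule in_closure_of_Diff_singleton[OF H F x A(2) ne])
    moreover have "A n - {x} \<subseteq> topspace X" using A(1) by blast
    ultimately show ?thesis using F unfolding Frechet_space_def by blast
  qed
  then obtain z where z: "\<And>n. range (z n) \<subseteq> A n - {x}" "\<And>n. limitin X (z n) (xs n) sequentially"
    by metis
  define B where "B n = range (z n)" for n :: nat
  have BX: "B n \<subseteq> topspace X" for n using z(1)[of n] A(1)[of n] by (auto simp: B_def)
  \<comment> \<open>The closure adds at most \<open>xs n\<close> to \<open>B n\<close>; both avoid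
    \<open>x\<close>, as \<open>x\<close> was removed from \<open>A n\<close>.\<close>
  have notx: "x \<notin> X closure_of (B n)" for n
    using closure_of_convergent_sequence[OF H F BX[unfolded B_def] z(2)] z(1)[of n] ne[of n]
    unfolding B_def by blast
  have "x \<in> X closure_of (\<Union>n. B n)"
  proof -
    have "xs n \<in> X closure_of (\<Union>n. B n)" for n
      by (rule limitin_sequentially_in_closure_of[OF z(2)]) (auto simp: B_def)
    then have "x \<in> X closure_of (X closure_of (\<Union>n. B n))"
      by (intro limitin_sequentially_in_closure_of[OF lim]) auto
    then show ?thesis by simp
  qed
  then obtain b where b: "range b \<subseteq> (\<Union>n. B n)" "limitin X b x sequentially"
    using F BX unfolding Frechet_space_def by (metis UN_least)
  have "infinite (range (\<lambda>n. f (b n)))"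
  proof
    assume fr: "finite (range (\<lambda>n. f (b n)))"
    \<comment> \<open>The indices of all sets \<open>A n\<close> on which some value of the sequence
      \<open>b\<close> is taken.\<close>
    define N where "N = (\<Union>v\<in>range (\<lambda>n. f (b n)). {n. v \<in> f ` A n})"
    have N: "finite N" unfolding N_def using fr fin by blast
    have "b j \<in> (\<Union>n\<in>N. B n)" for j
    proof -
      obtain n where n: "b j \<in> B n" using b(1) by blast
      then have "n \<in> N" using z(1)[of n] unfolding N_def B_def by blast
      then show ?thesis using n by blast
    qed
    then have "x \<in> X closure_of (\<Union>n\<in>N. B n)"
      by (intro limitin_sequentially_in_closure_of[OF b(2)]) blast
    then show False using notx N closure_of_Union[of "B ` N" X] by simp
  qed
  moreover have "range b \<subseteq> topspace X" using b(1) BX by blast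
  ultimately show ?thesis using b(2) unfolding sequentially_infinite_at_def by blast
qed

section \<open>Closedness of \<open>SI\<close>\<close>

lemma in_closure_of_avoid_finite:
  assumes lim: "limitin X s a sequentially" and inf: "infinite (range (\<lambda>n. f (s n)))"
    and F: "finite F"
  shows "a \<in> X closure_of (s ` {k. f (s k) \<notin> F})"
  unfolding in_closure_of
proof (intro conjI allI impI)
  show "a \<in> topspace X" using lim by (simp add: limitin_def)
  fix U assume "a \<in> U \<and> openin X U"
  then obtain N where N: "\<And>n. N \<le> n \<Longrightarrow> s n \<in> U"
    using lim unfolding limitin_sequentially by blast
  \<comment> \<open>\<open>F\<close> and the terms before \<open>N\<close> account for finitely many
    values only, so a new value appears at a late index.\<close>
  have "\<not> range (\<lambda>n. f (s n)) \<subseteq> F \<union> (\<lambda>n. f (s n)) ` {..<N}"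
    using inf F by (meson finite_UnI finite_imageI finite_lessThan finite_subset)
  then obtain k where "f (s k) \<notin> F" "\<not> k < N" by blast
  then show "\<exists>y. y \<in> s ` {k. f (s k) \<notin> F} \<and> y \<in> U" using N by (auto simp: not_less)
qed

lemma closedin_SI:
  assumes H: "sequentially_Hausdorff_space X" and F: "Frechet_space X"
  shows "closedin X (SI X f)"
proof -
  have SIX: "SI X f \<subseteq> topspace X" by (auto simp: SI_def)
  have "X closure_of SI X f \<subseteq> SI X f"
  proof
    fix x assume "x \<in> X closure_of SI X f"
    then obtain xs where xs: "range xs \<subseteq> SI X f" "limitin X xs x sequentially"
      using F SIX unfolding Frechet_space_def by metis
    have x: "x \<in> topspace X" using xs(2) by (simp add: limitin_def)
    show "x \<in> SI X f"
    proof (rule ccontr)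
      assume nx: "x \<notin> SI X f"
      have "\<forall>n. \<exists>s. range s \<subseteq> topspace X \<and> limitin X s (xs n) sequentially
          \<and> infinite (range (\<lambda>k. f (s k)))"
        using xs(1) unfolding SI_def sequentially_infinite_at_def by blast
      then obtain z where z: "\<And>n. range (z n) \<subseteq> topspace X"
        "\<And>n. limitin X (z n) (xs n) sequentially" "\<And>n. infinite (range (\<lambda>k. f (z n k)))"
        by metis
      \<comment> \<open>Diagonal choice: the value \<open>f (z i j)\<close> belongs to
        \<open>V n\<close> as soon as \<open>n\<close> reaches \<open>max i j\<close>, so it is
        discarded from all later \<open>A n\<close>.\<close>
      define V where "V n = (\<lambda>(i, j). f (z i j)) ` ({..n} \<times> {..n})" for n :: nat
      define A where "A n = z n ` {k. f (z n k) \<notin> V n}" for n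
      have "finite {n. v \<in> f ` A n}" for v
      proof (cases "\<exists>i j. v = f (z i j)")
        case True
        then obtain i j where ij: "v = f (z i j)" by blast
        have "n < max i j" if "v \<in> f ` A n" for n
        proof (rule ccontr)
          assume "\<not> n < max i j"
          then have "v \<in> V n" unfolding V_def ij by force
          then show False using that unfolding A_def by blast
        qed
        then have "{n. v \<in> f ` A n} \<subseteq> {..<max i j}" by blast
        then show ?thesis using finite_subset by blast
      next
        case False
        then have "{n. v \<in> f ` A n} = {}" unfolding A_def by blast
        then show ?thesis by simp
      qed
      moreover have "A n \<subseteq> topspace X" for n using z(1)[of n] by (auto simp: A_def)
      moreover have "xs n \<in> X closure_of (A n)" for n
        unfolding A_def by (rule in_closure_of_avoid_finite[OF z(2,3)]) (simp add: V_def)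
      moreover have "xs n \<noteq> x" for n using xs(1) nx by blast
      ultimately have "sequentially_infinite_at X f x"
        using sequentially_infinite_at_limit[OF H F xs(2)] by blast
      then show False using nx x by (simp add: SI_def)
    qed
  qed
  then show ?thesis using SIX closure_of_subset_eq by blast
qed

section \<open>Comparison of \<open>SI\<close> with \<open>LI\<close>\<close>

lemma SI_subset_LI: "SI X f \<subseteq> LI X f"
proof
  fix x assume x: "x \<in> SI X f"
  then obtain s where s: "limitin X s x sequentially" "infinite (range (\<lambda>n. f (s n)))"
    unfolding SI_def sequentially_infinite_at_def by blast
  \<comment> \<open>Discarding the finitely many values in \<open>f\<close>
    U\<open>leaves\<close>x\<open>in the closure, so\<close>U\<open>would contain a point whose value is not in\<close>f
    \<open>U\<close>.\<close>
  have False if U: "openin X U" "x \<in> U" "finite (f ` U)" for U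
    using in_closure_of_avoid_finite[OF s U(3)] U(1,2) unfolding in_closure_of by blast
  then show "x \<in> LI X f"
    using x unfolding SI_def LI_def locally_infinite_at_def locally_finite_at_def by blast
qed

text \<open>If only finitely many fibres accumulated at \<open>x\<close>, the points in all other
  fibres would still accumulate there. A sequence of such points converging to \<open>x\<close> has
  finite image because \<open>x\<close> is not in \<open>SI\<close>, so one of those other fibres
  accumulates at \<open>x\<close> after all.\<close>

lemma infinite_accumulating_fibres:
  fixes X :: "'a topology"
  assumes F: "Frechet_space X" and x: "x \<in> LI X f" "x \<notin> SI X f"
  shows "infinite {v. x \<in> X closure_of {z \<in> topspace X. f z = v}}" (is "infinite ?S")
proof
  assume fin: "finite ?S"
  have xX: "x \<in> topspace X" using x(1) by (simp add: LI_def)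
  have "x \<in> X closure_of {z \<in> topspace X. f z \<notin> ?S}"
    unfolding in_closure_of[of x X "{z \<in> topspace X. f z \<notin> ?S}"]
  proof (intro conjI allI impI)
    fix U assume U: "x \<in> U \<and> openin X U"
    then have "infinite (f ` U)"
      using x(1) unfolding LI_def locally_infinite_at_def locally_finite_at_def by blast
    then have "\<not> f ` U \<subseteq> ?S" using fin finite_subset by blast
    then obtain y where "y \<in> U" "f y \<notin> ?S" by blast
    then show "\<exists>y. y \<in> {z \<in> topspace X. f z \<notin> ?S} \<and> y \<in> U"
      using U openin_subset by fastforce
  qed (rule xX)
  moreover have "{z \<in> topspace X. f z \<notin> ?S} \<subseteq> topspace X" by (rule Collect_restrict)
  ultimately have "\<exists>s :: nat \<Rightarrow> 'a. range s \<subseteq> {z \<in> topspace X. f z \<notin> ?S} \<and> limitin X s x sequentially"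
    by (intro F[unfolded Frechet_space_def, rule_format] conjI)
  then obtain s :: "nat \<Rightarrow> 'a"
    where s: "range s \<subseteq> {z \<in> topspace X. f z \<notin> ?S}" "limitin X s x sequentially"
    by (elim exE conjE)
  have "range s \<subseteq> topspace X" using s(1) by blast
  then have R: "finite (range (\<lambda>n. f (s n)))"
    using x(2) xX s(2) unfolding SI_def sequentially_infinite_at_def by blast
  have "x \<in> X closure_of (\<Union>v\<in>range (\<lambda>n. f (s n)). {z \<in> topspace X. f z = v})"
    by (rule limitin_sequentially_in_closure_of[OF s(2)]) (use s(1) in blast)
  then obtain n where "x \<in> X closure_of {z \<in> topspace X. f z = f (s n)}"
    using closure_of_Union[of "(\<lambda>v. {z \<in> topspace X. f z = v}) ` range (\<lambda>n. f (s n))" X] R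
    by auto
  then show False using s(1) by blast
qed

lemma inj_choice_from_infinite_sets:
  fixes S :: "nat \<Rightarrow> 'b set"
  assumes "\<And>n. infinite (S n)"
  shows "\<exists>v. inj v \<and> (\<forall>n. v n \<in> S n)"
proof -
  have "\<exists>v. \<forall>n. v n \<in> S n \<and> v n \<notin> v ` {..<n}"
  proof (rule dependent_wellorder_choice)
    fix n :: nat and v :: "nat \<Rightarrow> 'b"
    show "\<exists>r. r \<in> S n \<and> r \<notin> v ` {..<n}"
      using assms[of n] by (meson finite_imageI finite_lessThan finite_subset subsetI)
  next
    fix r :: 'b and g h :: "nat \<Rightarrow> 'b" and n :: nat
    assume "\<And>m. m < n \<Longrightarrow> g m = h m"
    then have "g ` {..<n} = h ` {..<n}" by (auto intro: image_cong)
    then show "(r \<in> S n \<and> r \<notin> g ` {..<n}) = (r \<in> S n \<and> r \<notin> h ` {..<n})" by simp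
  qed
  then obtain v where v: "\<And>n. v n \<in> S n" "\<And>n. v n \<notin> v ` {..<n}" by blast
  have "inj v"
    by (rule linorder_injI) (metis v(2) imageI lessThan_iff)
  then show ?thesis using v(1) by blast
qed

lemma LI'_subset_SI:
  assumes H: "sequentially_Hausdorff_space X" and F: "Frechet_space X"
  shows "LI' X f \<subseteq> SI X f"
proof
  fix x assume x: "x \<in> LI' X f"
  have LIX: "LI X f \<subseteq> topspace X" by (auto simp: LI_def)
  have xLI: "x \<in> LI X f" and niso: "\<not> openin (subtopology X (LI X f)) {x}"
    using x unfolding LI'_def nonisolated_points_def by auto
  show "x \<in> SI X f"
  proof (rule ccontr)
    assume nx: "x \<notin> SI X f"
    have "x \<in> X closure_of (LI X f - SI X f - {x})"
      unfolding in_closure_of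
    proof (intro conjI allI impI)
      show xX: "x \<in> topspace X" using xLI LIX by blast
      fix U assume U: "x \<in> U \<and> openin X U"
      \<comment> \<open>Closedness of \<open>SI\<close> allows shrinking the neighbourhood, so that
        the second point of \<open>LI\<close> found in it lies outside \<open>SI\<close>.\<close>
      have op: "openin X (U - SI X f)" using U closedin_SI[OF H F] by blast
      have "(U - SI X f) \<inter> LI X f \<noteq> {x}"
        using niso openin_subtopology_Int[OF op] by metis
      moreover have "x \<in> (U - SI X f) \<inter> LI X f" using U nx xLI by blast
      ultimately show "\<exists>y. y \<in> LI X f - SI X f - {x} \<and> y \<in> U" by blast
    qed
    moreover have "LI X f - SI X f - {x} \<subseteq> topspace X" using LIX by blast
    ultimately obtain xs
      where xs: "range xs \<subseteq> LI X f - SI X f - {x}" "limitin X xs x sequentially"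
      using F unfolding Frechet_space_def by blast
    have "infinite {v. xs n \<in> X closure_of {z \<in> topspace X. f z = v}}" for n
      using xs(1) by (intro infinite_accumulating_fibres[OF F]) auto
    from inj_choice_from_infinite_sets[of "\<lambda>n. {v. xs n \<in> X closure_of {z \<in> topspace X. f z = v}}", OF this]
    obtain v where v: "inj v" "\<And>n. xs n \<in> X closure_of {z \<in> topspace X. f z = v n}" by auto
    \<comment> \<open>Injectivity of \<open>v\<close> makes the fibres pairwise different, so
      \<open>w\<close> is taken on at most one of them.\<close>
    have "finite {n. w \<in> f ` {z \<in> topspace X. f z = v n}}" for w
    proof (rule finite_subset)
      show "{n. w \<in> f ` {z \<in> topspace X. f z = v n}} \<subseteq> v -` {w}" by auto
      show "finite (v -` {w})" using v(1) by (simp add: finite_vimageI)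
    qed
    moreover have "xs n \<noteq> x" for n using xs(1) by blast
    ultimately have "sequentially_infinite_at X f x"
      by (rule sequentially_infinite_at_limit[OF H F xs(2) _ Collect_restrict v(2), rotated])
    then show False using nx xLI LIX by (auto simp: SI_def)
  qed
qed

lemma LI_subset_SI_strong_Frechet:
  assumes F: "Frechet_space X" and sF: "strong_Frechet_space X"
  shows "LI X f \<subseteq> SI X f"
proof
  fix x assume x: "x \<in> LI X f"
  then have xX: "x \<in> topspace X" by (simp add: LI_def)
  show "x \<in> SI X f"
  proof (rule ccontr)
    assume nx: "x \<notin> SI X f"
    obtain v :: "nat \<Rightarrow> 'b"
      where v: "inj v" "range v \<subseteq> {v. x \<in> X closure_of {z \<in> topspace X. f z = v}}"
      using infinite_countable_subset[OF infinite_accumulating_fibres[OF F x nx]] by blast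
    \<comment> \<open>The tails decrease, and each contains the fibre over \<open>v n\<close>, which
      already accumulates at \<open>x\<close>.\<close>
    define A where "A n = {z \<in> topspace X. f z \<in> v ` {n..}}" for n :: nat
    have "decseq A" unfolding A_def by (intro decseq_SucI) force
    moreover have "A n \<subseteq> topspace X" for n by (auto simp: A_def)
    moreover have "x \<in> X closure_of (A n)" for n
    proof -
      have "{z \<in> topspace X. f z = v n} \<subseteq> A n" by (auto simp: A_def)
      then show ?thesis using v(2) closure_of_mono by blast
    qed
    ultimately obtain s where s: "\<And>n. s n \<in> A n" "limitin X s x sequentially"
      using sF unfolding strong_Frechet_space_def by blast
    \<comment> \<open>The value at \<open>s n\<close> is some \<open>v m\<close> with
      \<open>n \<le> m\<close>, so unboundedly many indices occur; injectivity of \<open>v\<close>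
      turns them into infinitely many values.\<close>
    have "infinite (v -` range (\<lambda>n. f (s n)))"
      unfolding infinite_nat_iff_unbounded_le
    proof
      fix n
      obtain m where "n \<le> m" "f (s n) = v m" using s(1)[of n] by (auto simp: A_def)
      then show "\<exists>m\<ge>n. m \<in> v -` range (\<lambda>n. f (s n))" by (metis rangeI vimageI)
    qed
    then have "infinite (range (\<lambda>n. f (s n)))" using v(1) finite_vimageI by blast
    moreover have "range s \<subseteq> topspace X" using s(1) by (auto simp: A_def)
    ultimately show False
      using nx xX s(2) unfolding SI_def sequentially_infinite_at_def by blast
  qed
qed

theorem theorem4:
  fixes X :: "'a topology" and Y :: "'b topology" and f :: "'a \<Rightarrow> 'b"
  assumes "sequentially_Hausdorff_space X" and "Frechet_space X"
    and "Hausdorff_space Y"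
    and "f \<in> topspace X \<rightarrow> topspace Y"
    and "compact_preserving X Y f"
  shows "closedin X (SI X f)
    \<and> (LI' X f \<subseteq> SI X f \<and> SI X f \<subseteq> LI X f)
    \<and> (strong_Frechet_space X \<longrightarrow> SI X f = LI X f)"
  by (intro conjI impI equalityI closedin_SI LI'_subset_SI SI_subset_LI
      LI_subset_SI_strong_Frechet assms)

end
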